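(* Assume that $\mu(\mathcal M,W)<\infty$, and let $\mathcal S(\cdot,\mathcal M):U\to[0,\infty)$ satisfy, for some constants $0<c\le C<\infty$, $$c\,\mathrm{dist}(v,\mathcal M)\le\mathcal S(v,\mathcal M)\le C\,\mathrm{dist}(v,\mathcal M)\qquad\text{for all }v\in U.$$ Then for all $u\in\mathcal M$ and $w=P_Wu$, $$\|u-A^{\mathrm{dic}}_{\mathcal S}(w)\|_U\ \le\ \delta_0+2\kappa\,\mu(\mathcal M,W)\,\min_{V\in\mathcal L(w)}\|u-A_V(w)\|_U,\qquad \kappa:=\frac Cc .$$
   Context: **Space.** $U$ is a real Hilbert space of finite dimension $\mathcal N$, identified with $\mathbb R^{\mathcal N}$ with inner product $\langle x,y\rangle_U=x^{T}\mathbf R_Uy$, $\mathbf R_U$ symmetric positive definite. $W\subset U$ is a subspace of dimension $m$ (observation space), $W^\perp$ its orthogonal complement, and $P_W$ the orthogonal projection onto $W$ in $U$. $\mathcal M=\{u(\xi):\xi\in\mathcal P\}\subset U$ is the set of solutions of a parameter-dependent equation, and $\mathrm{dist}(v,\mathcal M)=\inf_{z\in\mathcal M}\|v-z\|_U$. **One-space recovery.** For a subspace $V\subset U$ with $V\cap W^\perp=\{0\}$ and $w\in W$, $A_V(w):=v^*+\eta^*$ with $v^*:=\arg\min_{v\in V}\|w-P_Wv\|_U$ and $\eta^*:=w-P_Wv^*$. **Dictionary library.** $\mathcal D_K=\{v^{(1)},\dots,v^{(K)}\}\subset U$ is a dictionary of vectors with $\|v^{(k)}\|_U=1$. $\mathbf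 V\in\mathbb R^{\mathcal N\times K}$ is the matrix with columns $v^{(k)}$, $\mathbf W\in\mathbb R^{\mathcal N\times m}$ is a matrix whose columns form a $U$-orthonormal basis of $W$, and $\mathbf C:=\mathbf W^{T}\mathbf R_U\mathbf V\in\mathbb R^{m\times K}$. For $w\in W$, $\mathbf w\in\mathbb R^m$ is defined by $w=\mathbf W\mathbf w$. Standing assumption: for all $\alpha>0$ the problem $\min_{\mathbf x\in\mathbb R^K}\frac12\|\mathbf C\mathbf x-\mathbf w\|_2^2+\alpha\|\mathbf x\|_1$ has a unique solution, denoted $\mathbf x^*_\alpha(w)$ (it then has at most $m$ nonzero entries). Set $V_\alpha(w):=\mathrm{span}\{v^{(i)}: \mathbf x^*_\alpha(w)_i\ne0\}$ and $\mathcal L(w):=\{V_\alpha(w):\alpha>0\}$ (a finite set of subspaces). **Dictionary-based recovery.** $A^{\mathrm{dic}}_{\mathcal S}(w):=A_{V_{\mathcal S}(w)}(w)$ where $V_{\mathcal S}(w)\in\arg\min_{V\in\mathcal L(w)}\mathcal S(A_V(w),\mathcal M)$. **Stability constant.** For $\sigma\ge0$, $\mathcal M_\sigma:=\{v\in U:\mathrm{dist}(v,\mathcal M)\le\sigma\}$, $U_w:=w+W^\perp$, $\delta_\sigma:=\max_{w\in W}\mathrm{diam}(\mathcal M_\sigma\cap U_w)$ (a supremum if not attained), and $\mu(\mathcal M,W):=\frac12\sup_{\sigma>0}\frac{\delta_\sigma-\delta_0}{\sigma}$. *)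

theory Defs
  imports "HOL-Analysis.Analysis"
begin

text \<open>
  The space \<open>U\<close> is \<open>real^'n\<close> with the inner product \<open>x\<^sup>T R y\<close>, where \<open>R\<close> is symmetric positive
  definite. All metric notions below (norm, orthogonality, projection, distance, diameter) refer
  to this inner product and not to the one of the type class.
\<close>

definition spd :: "real^'n^'n \<Rightarrow> bool" where
  "spd R \<longleftrightarrow> transpose R = R \<and> (\<forall>x. x \<noteq> 0 \<longrightarrow> x \<bullet> (R *v x) > 0)"

definition innerU :: "real^'n^'n \<Rightarrow> real^'n \<Rightarrow> real^'n \<Rightarrow> real" where
  "innerU R x y = x \<bullet> (R *v y)"

definition normU :: "real^'n^'n \<Rightarrow> real^'n \<Rightarrow> real" where
  "normU R x = sqrt (innerU R x x)"

definition perpU :: "real^'n^'n \<Rightarrow> (real^'n) set \<Rightarrow> (real^'n) set" where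
  "perpU R W = {x. \<forall>z\<in>W. innerU R x z = 0}"

definition projU :: "real^'n^'n \<Rightarrow> (real^'n) set \<Rightarrow> real^'n \<Rightarrow> real^'n" where
  "projU R W x = (THE p. p \<in> W \<and> x - p \<in> perpU R W)"

text \<open>Only meaningful for nonempty \<open>M\<close>.\<close>

definition distU :: "real^'n^'n \<Rightarrow> real^'n \<Rightarrow> (real^'n) set \<Rightarrow> real" where
  "distU R v M = (INF z\<in>M. normU R (v - z))"

definition orthonormal_basisU :: "real^'n^'n \<Rightarrow> (real^'n) set \<Rightarrow> real^'m^'n \<Rightarrow> bool" where
  "orthonormal_basisU R W B \<longleftrightarrow>
     (\<forall>i j. innerU R (column i B) (column j B) = (if i = j then 1 else 0)) \<and>
     span (columns B) = W"

text \<open>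
  The minimiser \<open>v\<^sup>*\<close> is unique when \<open>V \<inter> W\<^sup>\<bottom> = {0}\<close>, so that the choice made by
  \<^const>\<open>arg_min_on\<close> is immaterial there.
\<close>

definition recovery :: "real^'n^'n \<Rightarrow> (real^'n) set \<Rightarrow> (real^'n) set \<Rightarrow> real^'n \<Rightarrow> real^'n" where
  "recovery R W V w =
     (let v = arg_min_on (\<lambda>v. normU R (w - projU R W v)) V;
          \<eta> = w - projU R W v
      in v + \<eta>)"

text \<open>The columns of \<open>D\<close> are the dictionary, those of \<open>B\<close> a \<open>U\<close>-orthonormal basis of \<open>W\<close>.\<close>

definition obs_matrix :: "real^'n^'n \<Rightarrow> real^'m^'n \<Rightarrow> real^'k^'n \<Rightarrow> real^'k^'m" where
  "obs_matrix R B D = transpose B ** R ** D"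

definition coords :: "real^'m^'n \<Rightarrow> real^'n \<Rightarrow> real^'m" where
  "coords B w = (THE c. w = B *v c)"

definition lasso :: "real^'k^'m \<Rightarrow> real^'m \<Rightarrow> real \<Rightarrow> real^'k \<Rightarrow> real" where
  "lasso A b \<alpha> x = 1/2 * (norm (A *v x - b))\<^sup>2 + \<alpha> * (\<Sum>i\<in>UNIV. \<bar>x $ i\<bar>)"

definition lasso_unique ::
    "real^'n^'n \<Rightarrow> real^'m^'n \<Rightarrow> real^'k^'n \<Rightarrow> real \<Rightarrow> real^'n \<Rightarrow> bool" where
  "lasso_unique R B D \<alpha> w \<longleftrightarrow>
     (\<exists>!x. is_arg_min (lasso (obs_matrix R B D) (coords B w) \<alpha>) (\<lambda>_. True) x)"

definition lasso_sol ::
    "real^'n^'n \<Rightarrow> real^'m^'n \<Rightarrow> real^'k^'n \<Rightarrow> real \<Rightarrow> real^'n \<Rightarrow> real^'k" where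
  "lasso_sol R B D \<alpha> w =
     (THE x. is_arg_min (lasso (obs_matrix R B D) (coords B w) \<alpha>) (\<lambda>_. True) x)"

text \<open>
  If the lasso problem has a unique solution, the columns of the observation matrix on the support
  of that solution are linearly independent (otherwise a kernel direction would give further
  solutions). Hence the space below meets \<open>W\<^sup>\<bottom>\<close> only in \<open>0\<close>, as required for the recovery map.
\<close>

definition dict_space ::
    "real^'n^'n \<Rightarrow> real^'m^'n \<Rightarrow> real^'k^'n \<Rightarrow> real \<Rightarrow> real^'n \<Rightarrow> (real^'n) set" where
  "dict_space R B D \<alpha> w = span {column i D | i. lasso_sol R B D \<alpha> w $ i \<noteq> 0}"

definition dict_library ::
    "real^'n^'n \<Rightarrow> real^'m^'n \<Rightarrow> real^'k^'n \<Rightarrow> real^'n \<Rightarrow> (real^'n) set set" where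
  "dict_library R B D w = {dict_space R B D \<alpha> w | \<alpha>. \<alpha> > 0}"

lemma finite_dict_library: "finite (dict_library R B D w)"
proof (rule finite_subset)
  show "dict_library R B D w \<subseteq> span ` Pow (columns D)"
    by (auto simp: dict_library_def dict_space_def columns_def)
  show "finite (span ` Pow (columns D))"
    by (simp add: columns_def full_SetCompr_eq)
qed

lemma dict_library_nonempty: "dict_library R B D w \<noteq> {}"
  by (auto simp: dict_library_def intro: exI[of _ 1])

text \<open>
  A selection picks, for each \<open>w\<close>, some minimiser \<open>V\<^sub>S(w)\<close> of \<open>S (A\<^sub>V(w))\<close> over the library;
  the argument \<open>S\<close> stands for \<open>S(\<cdot>, M)\<close>.
\<close>

definition dict_selection ::
    "real^'n^'n \<Rightarrow> (real^'n) set \<Rightarrow> real^'m^'n \<Rightarrow> real^'k^'n \<Rightarrow> (real^'n \<Rightarrow> real) \<Rightarrow>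
     (real^'n \<Rightarrow> (real^'n) set) \<Rightarrow> bool" where
  "dict_selection R W B D S VS \<longleftrightarrow>
     (\<forall>w\<in>W. is_arg_min (\<lambda>V. S (recovery R W V w)) (\<lambda>V. V \<in> dict_library R B D w) (VS w))"

definition dict_recovery ::
    "real^'n^'n \<Rightarrow> (real^'n) set \<Rightarrow> (real^'n \<Rightarrow> (real^'n) set) \<Rightarrow> real^'n \<Rightarrow> real^'n" where
  "dict_recovery R W VS w = recovery R W (VS w) w"

text \<open>
  Diameters may be infinite, so these quantities live in \<^typ>\<open>ennreal\<close>; there the diameter of the
  empty set is \<open>0\<close>. Since \<open>delta\<close> is monotone in \<open>\<sigma>\<close>, the truncated subtraction in \<open>mu\<close> is the
  ordinary one; the indeterminate case \<open>\<infinity> - \<infinity>\<close> is \<open>\<infinity>\<close>, so \<open>mu < \<infinity>\<close> forces all \<open>delta\<close> to be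
  finite.
\<close>

definition diamU :: "real^'n^'n \<Rightarrow> (real^'n) set \<Rightarrow> ennreal" where
  "diamU R A = (SUP (x, y)\<in>A \<times> A. ennreal (normU R (x - y)))"

definition fattening :: "real^'n^'n \<Rightarrow> (real^'n) set \<Rightarrow> real \<Rightarrow> (real^'n) set" where
  "fattening R M \<sigma> = {v. distU R v M \<le> \<sigma>}"

definition fibre :: "real^'n^'n \<Rightarrow> (real^'n) set \<Rightarrow> real^'n \<Rightarrow> (real^'n) set" where
  "fibre R W w = (+) w ` perpU R W"

definition delta :: "real^'n^'n \<Rightarrow> (real^'n) set \<Rightarrow> (real^'n) set \<Rightarrow> real \<Rightarrow> ennreal" where
  "delta R M W \<sigma> = (SUP w\<in>W. diamU R (fattening R M \<sigma> \<inter> fibre R W w))"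

definition mu :: "real^'n^'n \<Rightarrow> (real^'n) set \<Rightarrow> (real^'n) set \<Rightarrow> ennreal" where
  "mu R M W = 1/2 * (SUP \<sigma>\<in>{0<..}. (delta R M W \<sigma> - delta R M W 0) / ennreal \<sigma>)"

end

theory Submission imports Defs begin

text \<open>
  The selected reconstruction \<open>a\<close> and the true state \<open>u\<close> have the same observation \<open>w\<close>: the
  correction \<open>\<eta> = w - P\<^sub>W v\<close> restores the data whichever \<open>v\<close> it is applied to, so every one-space
  reconstruction lies on the fibre \<open>U\<^sub>w\<close>. The error of \<open>a\<close> is therefore bounded by
  \<open>\<delta>\<^sub>\<sigma>\<close> as soon as \<open>a\<close> is within distance \<open>\<sigma>\<close> of \<open>M\<close>, and \<open>\<delta>\<^sub>\<sigma> \<le> \<delta>\<^sub>0 + 2 \<mu> \<sigma>\<close> by the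
  definition of \<open>\<mu>\<close>.

  The surrogate supplies the right \<open>\<sigma>\<close>. Since \<open>a\<close> minimises \<open>S\<close> over the library, for each library
  space \<open>V\<close>
  \<open>c dist(a, M) \<le> S(a) \<le> S(A\<^sub>V(w)) \<le> C dist(A\<^sub>V(w), M) \<le> C \<parallel>u - A\<^sub>V(w)\<parallel>\<close>,
  the last step because \<open>u \<in> M\<close>. Hence \<open>\<sigma>\<close> can be taken to be \<open>\<kappa>\<close> times the smallest
  error over the library.
\<close>

lemma innerU_self_nonneg:
  assumes "spd R"
  shows "0 \<le> innerU R x x"
  using assms by (cases "x = 0") (auto simp: spd_def innerU_def less_imp_le)

lemma innerU_self_eq_0_iff:
  assumes "spd R"
  shows "innerU R x x = 0 \<longleftrightarrow> x = 0"
  using assms by (cases "x = 0") (force simp: spd_def innerU_def)+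

lemma normU_nonneg: "spd R \<Longrightarrow> 0 \<le> normU R x"
  by (simp add: normU_def innerU_self_nonneg)

lemma normU_minus_commute: "normU R (x - y) = normU R (y - x)"
  by (simp add: normU_def innerU_def matrix_vector_mult_diff_distrib inner_diff_left inner_diff_right)

lemma distU_le_normU:
  assumes "spd R" "z \<in> M"
  shows "distU R v M \<le> normU R (v - z)"
  unfolding distU_def
  by (rule cINF_lower) (auto simp: assms normU_nonneg intro!: bdd_belowI[of _ 0])

lemma subspace_perpU: "subspace (perpU R W)"
  by (auto simp: perpU_def subspace_def innerU_def inner_add_left)

lemma Int_perpU:
  assumes "spd R" "subspace W"
  shows "W \<inter> perpU R W = {0}"
  using subspace_0[OF assms(2)] subspace_0[OF subspace_perpU] innerU_self_eq_0_iff[OF assms(1)]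
  by (auto simp: perpU_def)

text \<open>
  In the Euclidean inner product \<open>W\<^sup>\<bottom>\<close> is the orthogonal complement of the image \<open>R W\<close>, which has
  the dimension of \<open>W\<close> because \<open>R\<close> is injective.
\<close>

lemma dim_perpU:
  fixes R :: "real^'n^'n"
  assumes "spd R" "subspace W"
  shows "dim (perpU R W) + dim W = CARD('n)"
proof -
  have inj: "inj ((*v) R)"
    unfolding vec.inj_iff_eq_0
    using assms(1) by (force simp: spd_def)
  have "dim ((*v) R ` W) = dim W"
    by (rule dim_image_eq) (use inj in \<open>auto intro: inj_on_subset matrix_vector_mul_linear\<close>)
  moreover have "perpU R W = {y \<in> UNIV. \<forall>x \<in> (*v) R ` W. orthogonal x y}"
    by (auto simp: perpU_def innerU_def orthogonal_def inner_commute)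
  moreover have "subspace ((*v) R ` W)"
    by (intro linear_subspace_image assms matrix_vector_mul_linear)
  ultimately show ?thesis
    using dim_subspace_orthogonal_to_vectors[of "(*v) R ` W" UNIV] by simp
qed

lemma projU_existence:
  fixes R :: "real^'n^'n"
  assumes "spd R" "subspace W"
  shows "\<exists>p\<in>W. x - p \<in> perpU R W"
proof -
  have "dim {a + b | a b. a \<in> W \<and> b \<in> perpU R W} = CARD('n)"
    using dim_sums_Int[OF assms(2) subspace_perpU, of R W] dim_perpU[OF assms]
    by (simp add: Int_perpU[OF assms])
  moreover have "subspace {a + b | a b. a \<in> W \<and> b \<in> perpU R W}"
    by (rule subspace_sums[OF assms(2) subspace_perpU])
  ultimately have "x \<in> {a + b | a b. a \<in> W \<and> b \<in> perpU R W}"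
    using dim_eq_full[of "{a + b | a b. a \<in> W \<and> b \<in> perpU R W}"]
    by (simp add: span_eq_iff[THEN iffD2])
  then show ?thesis
    by force
qed

lemma projU_works:
  assumes "spd R" "subspace W"
  shows "projU R W x \<in> W" "x - projU R W x \<in> perpU R W"
proof -
  have "p = q"
    if p: "p \<in> W" "x - p \<in> perpU R W" and q: "q \<in> W" "x - q \<in> perpU R W" for p q
  proof -
    have "p - q \<in> W"
      using p q assms(2) by (simp add: subspace_diff)
    moreover have "p - q \<in> perpU R W"
      using subspace_diff[OF subspace_perpU q(2) p(2)] by simp
    ultimately have "p - q \<in> W \<inter> perpU R W"
      by (rule IntI)
    then show "p = q"
      unfolding Int_perpU[OF assms] by simp
  qed
  then have "\<exists>!p. p \<in> W \<and> x - p \<in> perpU R W"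
    using projU_existence[OF assms, of x] by blast
  then have "projU R W x \<in> W \<and> x - projU R W x \<in> perpU R W"
    unfolding projU_def by (rule theI')
  then show "projU R W x \<in> W" "x - projU R W x \<in> perpU R W"
    by auto
qed

lemma mem_fibre_iff: "x \<in> fibre R W w \<longleftrightarrow> x - w \<in> perpU R W"
  unfolding fibre_def by (force simp: image_iff)

text \<open>
  The correction \<open>\<eta>\<close> gives \<open>v + \<eta> - w = v - P\<^sub>W v\<close>, and this lies in \<open>W\<^sup>\<bottom>\<close> for every \<open>v\<close>.
\<close>

lemma recovery_in_fibre:
  assumes "spd R" "subspace W"
  shows "recovery R W V w \<in> fibre R W w"
  using projU_works(2)[OF assms] by (simp add: mem_fibre_iff recovery_def Let_def)

lemma normU_le_delta:
  assumes "w \<in> W"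
    and "x \<in> fattening R M \<sigma> \<inter> fibre R W w" "y \<in> fattening R M \<sigma> \<inter> fibre R W w"
  shows "ennreal (normU R (x - y)) \<le> delta R M W \<sigma>"
proof -
  have "ennreal (normU R (x - y)) \<le> diamU R (fattening R M \<sigma> \<inter> fibre R W w)"
    unfolding diamU_def using assms(2,3) by (intro SUP_upper2[of "(x, y)"]) auto
  also have "\<dots> \<le> delta R M W \<sigma>"
    unfolding delta_def by (rule SUP_upper[OF assms(1)])
  finally show ?thesis .
qed

text \<open>
  The truncated subtraction in \<^const>\<open>mu\<close> satisfies \<open>a \<le> b + (a - b)\<close> for all extended values, so
  the bound also holds when some of the diameters are infinite.
\<close>

lemma delta_le_delta_0_mu:
  assumes "0 \<le> \<sigma>"
  shows "delta R M W \<sigma> \<le> delta R M W 0 + 2 * mu R M W * ennreal \<sigma>"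
proof (cases "\<sigma> = 0")
  case True
  then show ?thesis by simp
next
  case False
  with assms have \<sigma>: "0 < \<sigma>" by simp
  let ?d = "delta R M W \<sigma> - delta R M W 0"
  have "2 * mu R M W = (2 * (1/2)) * (SUP \<sigma>\<in>{0<..}. (delta R M W \<sigma> - delta R M W 0) / ennreal \<sigma>)"
    unfolding mu_def by (simp only: mult.assoc)
  also have "2 * (1/2) = (1::ennreal)"
    by (simp add: ennreal_times_divide ennreal_divide_self)
  finally have "?d / ennreal \<sigma> \<le> 2 * mu R M W"
    using \<sigma> by (auto intro!: SUP_upper)
  then have "?d / ennreal \<sigma> * ennreal \<sigma> \<le> 2 * mu R M W * ennreal \<sigma>"
    by (rule mult_right_mono) simp
  moreover have "?d / ennreal \<sigma> * ennreal \<sigma> = ?d"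
    using \<sigma> by (simp add: ennreal_divide_times)
  ultimately have "?d \<le> 2 * mu R M W * ennreal \<sigma>"
    by simp
  then show ?thesis
    by (simp add: ennreal_minus_le_iff)
qed

text \<open>
  A state \<open>u \<in> M\<close> belongs to every fattening of \<open>M\<close>, so it competes with \<open>a\<close> in the diameter that
  defines \<open>\<delta>\<^sub>\<sigma>\<close>.
\<close>

lemma normU_le_delta_0_mu:
  assumes "spd R" and "u \<in> M" and "w \<in> W"
    and "u \<in> fibre R W w" "a \<in> fibre R W w"
    and "0 \<le> \<sigma>" "distU R a M \<le> \<sigma>"
  shows "ennreal (normU R (u - a)) \<le> delta R M W 0 + 2 * mu R M W * ennreal \<sigma>"
proof -
  have "distU R u M \<le> normU R (u - u)"
    by (rule distU_le_normU) fact+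
  also have "\<dots> \<le> \<sigma>"
    using assms by (simp add: normU_def innerU_def)
  finally have "ennreal (normU R (u - a)) \<le> delta R M W \<sigma>"
    using assms by (intro normU_le_delta) (auto simp: fattening_def)
  also note delta_le_delta_0_mu[OF assms(6)]
  finally show ?thesis .
qed

text \<open>
  The equivalence constants turn a comparison of surrogate values into one of distances to \<open>M\<close>, at
  the price of the factor \<open>C / c\<close>; and as \<open>u \<in> M\<close>, the distance of \<open>b\<close> is at most its error.
\<close>

lemma distU_surrogate_minimiser:
  assumes "spd R" "u \<in> M" and "0 < c" "0 \<le> C"
    and S: "\<And>v. c * distU R v M \<le> S v" "\<And>v. S v \<le> C * distU R v M"
    and le: "S a \<le> S b"
  shows "distU R a M \<le> C / c * normU R (u - b)"
proof -
  have "distU R b M \<le> normU R (u - b)"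
    using distU_le_normU[OF assms(1,2), of b] by (simp add: normU_minus_commute)
  then have "C * distU R b M \<le> C * normU R (u - b)"
    using assms(4) by (rule mult_left_mono)
  then have "c * distU R a M \<le> C * normU R (u - b)"
    using S(1)[of a] le S(2)[of b] by linarith
  then show ?thesis
    using assms(3) by (simp add: field_simps)
qed

theorem corollary5p1:
  fixes R :: "real^'n^'n"
    and W M :: "(real^'n) set"
    and B :: "real^'m^'n"
    and D :: "real^'k^'n"
    and S :: "real^'n \<Rightarrow> real"
    and VS :: "real^'n \<Rightarrow> (real^'n) set"
    and c C \<kappa> :: real
  assumes "spd R"
    and "subspace W" and "dim W = CARD('m)"
    and "orthonormal_basisU R W B"
    and "\<And>k. normU R (column k D) = 1"
    and "\<And>\<alpha> w. \<alpha> > 0 \<Longrightarrow> w \<in> W \<Longrightarrow> lasso_unique R B D \<alpha> w"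
    and "mu R M W < \<infinity>"
    and "0 < c" and "c \<le> C"
    and "\<And>v. 0 \<le> S v"
    and "\<And>v. c * distU R v M \<le> S v \<and> S v \<le> C * distU R v M"
    and "dict_selection R W B D S VS"
    and "\<kappa> = C / c"
  shows "\<forall>u\<in>M. \<forall>w. w = projU R W u \<longrightarrow>
    ennreal (normU R (u - dict_recovery R W VS w))
      \<le> delta R M W 0
        + 2 * ennreal \<kappa> * mu R M W
            * ennreal (Min ((\<lambda>V. normU R (u - recovery R W V w)) ` dict_library R B D w))"
proof (intro ballI allI impI)
  fix u w
  assume u: "u \<in> M" and w: "w = projU R W u"
  let ?err = "\<lambda>V. normU R (u - recovery R W V w)"
  define a where "a = dict_recovery R W VS w"
  define m where "m = Min (?err ` dict_library R B D w)"
  note spd = assms(1) and W = assms(2)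
  have "m \<in> ?err ` dict_library R B D w"
    unfolding m_def by (intro Min_in) (simp_all add: finite_dict_library dict_library_nonempty)
  then obtain V where V: "V \<in> dict_library R B D w" and m: "m = ?err V"
    by auto
  have wW: "w \<in> W" and "u \<in> fibre R W w"
    using projU_works[OF spd W] by (simp_all add: w mem_fibre_iff)
  have "S a \<le> S (recovery R W V w)"
    using assms(12) wW V
    by (auto simp: dict_selection_def is_arg_min_linorder a_def dict_recovery_def)
  then have "distU R a M \<le> \<kappa> * m"
    unfolding m assms(13) using assms(8,9,11) by (intro distU_surrogate_minimiser[OF spd u, of c C S]) auto
  moreover have "0 \<le> m"
    unfolding m by (rule normU_nonneg[OF spd])
  moreover have "0 \<le> \<kappa>"
    using assms(8,9,13) by simp
  moreover have "a \<in> fibre R W w"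
    unfolding a_def dict_recovery_def by (rule recovery_in_fibre[OF spd W])
  ultimately have "ennreal (normU R (u - a)) \<le> delta R M W 0 + 2 * mu R M W * ennreal (\<kappa> * m)"
    using \<open>u \<in> fibre R W w\<close>
    by (intro normU_le_delta_0_mu[OF spd u wW]) auto
  also have "2 * mu R M W * ennreal (\<kappa> * m) = 2 * ennreal \<kappa> * mu R M W * ennreal m"
    using \<open>0 \<le> \<kappa>\<close> \<open>0 \<le> m\<close> by (simp add: ennreal_mult ac_simps)
  finally show "ennreal (normU R (u - dict_recovery R W VS w))
      \<le> delta R M W 0 + 2 * ennreal \<kappa> * mu R M W * ennreal (Min (?err ` dict_library R B D w))"
    unfolding a_def m_def .
qed

end
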